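(* Let $(X,\Sigma,\mu)$ be a $\sigma$-finite measure space, let $1\le p\le\infty$, $1\le q\le\infty$ with $\frac1p+\frac1q=1$, and let $A:L_p(X,\mu)\to L_p(X,\mu)$, $B:L_p(X,\mu)\to L_p(X,\mu)$ be nonzero operators defined, for almost every $t$, by $$(Ax)(t)=\int_{G_A}\sum_{i=1}^{l_A}a_i(t)c_i(s)x(s)\,d\mu_s,\qquad (Bx)(t)=\int_{G_B}\sum_{j=1}^{l_B}b_j(t)e_j(s)x(s)\,d\mu_s,$$ where $G_A,G_B\in\Sigma$, $l_A,l_B$ are positive integers, $a_i,b_j\in L_p(X,\mu)$, $c_i\in L_q(G_A,\mu)$, $e_j\in L_q(G_B,\mu)$ for $1\le i\le l_A$, $1\le j\le l_B$. Let $F(z)=\sum_{j=0}^{n_f}f_jz^j$ and $H(z)=\sum_{l=0}^{n_h}h_lz^l$ be polynomials with real coefficients. Put $G=G_A\cap G_B$ and $$\gamma_{i_1}=1,\qquad \gamma_{i_1,\ldots,i_m}=\prod_{l=1}^{m-1}Q_{G_A}(a_{i_{l+1}},c_{i_l}),\quad m\ge2 .$$ Then $H(A)B=BF(A)$ if and only if the following three conditions hold: 1. for almost every $(t,s)\in X\times G$, $$(h_0-f_0)\sum_{k=1}^{l_B}b_k(t)e_k(s)+\sum_{l=1}^{n_h}\sum_{k=1}^{l_B}\sum_{m_1,\ldots,m_l=1}^{l_A}h_l\,\gamma_{m_1,\ldots,m_l}\,a_{m_1}(t)\,Q_{G_A}(b_k,c_{m_l})\,e_k(s)$$ $$=\sum_{k=1}^{l_B}\sum_{j=1}^{n_f}\sum_{i_1,\ldots,i_j=1}^{l_A}f_j\,b_k(t)\,Q_{G_B}(e_k,a_{i_1})\,\gamma_{i_1,\ldots,i_j}\,c_{i_j}(s);$$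 2. for almost every $(t,s)\in X\times(G_A\setminus G)$, $$\sum_{k=1}^{l_B}\sum_{j=1}^{n_f}\sum_{i_1,\ldots,i_j=1}^{l_A}f_j\,b_k(t)\,Q_{G_B}(e_k,a_{i_1})\,\gamma_{i_1,\ldots,i_j}\,c_{i_j}(s)=0;$$ 3. for almost every $(t,s)\in X\times(G_B\setminus G)$, $$(f_0-h_0)\sum_{k=1}^{l_B}b_k(t)e_k(s)=\sum_{l=1}^{n_h}\sum_{k=1}^{l_B}\sum_{m_1,\ldots,m_l=1}^{l_A}h_l\,\gamma_{m_1,\ldots,m_l}\,Q_{G_A}(b_k,c_{m_l})\,a_{m_1}(t)\,e_k(s).$$
   Context: $L_p(X,\mu)$ is the Banach space of (classes of) real-valued measurable functions $f$ on $X$ with $\int_X|f|^pd\mu<\infty$ (essentially bounded functions if $p=\infty$), and similarly $L_q(\Lambda,\mu)$ for $\Lambda\in\Sigma$. The index in $d\mu_s$ indicates the variable of integration. For $\Lambda\in\Sigma$ and functions $u,v:\Lambda\to\mathbb{R}$ for which the integral exists and is finite, $Q_\Lambda(u,v)=\int_\Lambda u(t)v(t)\,d\mu$. For a polynomial $F(z)=\sum_j f_jz^j$, $F(A)=\sum_j f_jA^j$ with $A^0$ the identity operator. "Almost every $(t,s)$" refers to the product measure $\mu\times\mu$. *)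

theory Defs
  imports "HOL-Analysis.Analysis" "HOL-Computational_Algebra.Polynomial"
begin

text \<open>
  Elements of \<open>L\<^sub>p\<close> are represented by functions; two of them are the same element iff they agree
  almost everywhere. The exponent ranges over the extended nonnegative reals, so that
  \<open>1 / p + 1 / q = 1\<close> covers the pairs \<open>(1, \<infinity>)\<close> and \<open>(\<infinity>, 1)\<close>.
  For a measurable set \<open>G\<close>, the space \<open>L\<^sub>q(G, \<mu>)\<close> is \<open>Lp (restrict_space M G) q\<close>;
  the values of its members outside \<open>G\<close> are irrelevant.
\<close>

definition Lp :: "'a measure \<Rightarrow> ennreal \<Rightarrow> ('a \<Rightarrow> real) set" where
  "Lp M p = {f \<in> borel_measurable M.
     if p = \<infinity> then (\<exists>C. AE x in M. \<bar>f x\<bar> \<le> C)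
     else (\<integral>\<^sup>+x. ennreal (\<bar>f x\<bar> powr enn2real p) \<partial>M) < \<infinity>}"

definition Q :: "'a measure \<Rightarrow> 'a set \<Rightarrow> ('a \<Rightarrow> real) \<Rightarrow> ('a \<Rightarrow> real) \<Rightarrow> real" where
  "Q M \<Lambda> u v = (LINT t:\<Lambda>|M. u t * v t)"

text \<open>
  A multi-index \<open>(i\<^sub>1, \<dots>, i\<^sub>m)\<close> with entries in \<open>{1..k}\<close> is a function
  \<open>i \<in> {1..m} \<rightarrow>\<^sub>E {1..k}\<close>. For \<open>m = 1\<close> the product below is empty, hence \<open>1\<close>.
\<close>

definition gam :: "'a measure \<Rightarrow> 'a set \<Rightarrow> (nat \<Rightarrow> 'a \<Rightarrow> real) \<Rightarrow> (nat \<Rightarrow> 'a \<Rightarrow> real)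
    \<Rightarrow> nat \<Rightarrow> (nat \<Rightarrow> nat) \<Rightarrow> real" where
  "gam M G a c m i = (\<Prod>l\<in>{1..<m}. Q M G (a (i (l + 1))) (c (i l)))"

definition poly_op :: "real poly \<Rightarrow> (('a \<Rightarrow> real) \<Rightarrow> ('a \<Rightarrow> real)) \<Rightarrow> ('a \<Rightarrow> real) \<Rightarrow> ('a \<Rightarrow> real)" where
  "poly_op F A x = (\<lambda>t. \<Sum>j\<le>degree F. coeff F j * (A ^^ j) x t)"

end

theory Submission
  imports Defs
begin

text \<open>
  An operator with separated kernel, \<open>T x = \<Sum>\<^sub>i Q\<^sub>G(c\<^sub>i, x) a\<^sub>i\<close>, composes by pairing: applying \<open>T\<close> once more
  to a combination of the \<open>a\<^sub>i\<close> only multiplies coefficients by numbers \<open>Q\<^sub>G(c\<^sub>i, a\<^sub>j)\<close>. So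
  \<open>T\<^sup>j x\<close>, for \<open>j \<ge> 1\<close>, is the sum over all multi-indices \<open>i\<close> of length \<open>j\<close> of
  \<open>\<gamma>\<^sub>i Q\<^sub>G(c\<^bsub>i(j)\<^esub>, x) a\<^bsub>i(1)\<^esub>\<close> (\<open>funpow_AE\<close>). Inserting this in \<open>H(A)B x - B F(A) x\<close> shows that the
  difference is again an integral operator of finite rank; its kernel is
  \<open>1\<^bsub>G\<^sub>B\<^esub>(s) ((h\<^sub>0 - f\<^sub>0) P(t,s) + R(t,s)) - 1\<^bsub>G\<^sub>A\<^esub>(s) S(t,s)\<close>, where \<open>P\<close> is the kernel of \<open>B\<close> and \<open>R\<close>, \<open>S\<close>
  collect the positive powers of \<open>A\<close> in \<open>H(A)B\<close> and in \<open>B F(A)\<close>. The three conditions say exactly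
  that this kernel vanishes for \<open>s\<close> in \<open>G\<close>, in \<open>G\<^sub>A - G\<close> and in \<open>G\<^sub>B - G\<close>; elsewhere it is zero anyway.

  It remains to see that a finite-rank operator \<open>x \<mapsto> \<Sum>\<^sub>r u\<^sub>r \<integral> v\<^sub>r x\<close> vanishes on \<open>L\<^sub>p\<close> iff its
  kernel \<open>\<Sum>\<^sub>r u\<^sub>r(t) v\<^sub>r(s)\<close> vanishes almost everywhere (\<open>finite_rank_kernel_eq_0_iff\<close>). One direction is
  Fubini's theorem. For the other, each \<open>x\<close> comes with its own exceptional null set of \<open>t\<close>; but
  only the vector \<open>(\<integral> v\<^sub>r x)\<^sub>r\<close> matters, and these vectors live in a separable space, so a countable
  dense family of them provides one null set that serves every \<open>x\<close> (\<open>AE_forall_linear_relation\<close>).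
  For all other \<open>t\<close> the section \<open>K(t, \<cdot>)\<close> annihilates \<open>L\<^sub>p\<close>, hence is zero almost everywhere.
\<close>

section \<open>Closure properties of \<open>L\<^sub>p\<close>\<close>

lemma Lp_measurable: "f \<in> Lp N p \<Longrightarrow> f \<in> borel_measurable N"
  by (simp add: Lp_def)

lemma Lp_cmult:
  assumes "f \<in> Lp N p"
  shows "(\<lambda>x. k * f x) \<in> Lp N p"
proof (cases "p = \<infinity>")
  case True
  then obtain C where C: "AE x in N. \<bar>f x\<bar> \<le> C" and [measurable]: "f \<in> borel_measurable N"
    using assms by (auto simp: Lp_def)
  have "AE x in N. \<bar>k * f x\<bar> \<le> \<bar>k\<bar> * C"
    using C by eventually_elim (simp add: abs_mult mult_left_mono)
  then show ?thesis using True by (auto simp: Lp_def)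
next
  case False
  then have fin: "(\<integral>\<^sup>+x. ennreal (\<bar>f x\<bar> powr enn2real p) \<partial>N) < \<infinity>"
    and [measurable]: "f \<in> borel_measurable N"
    using assms by (auto simp: Lp_def)
  have "(\<integral>\<^sup>+x. ennreal (\<bar>k * f x\<bar> powr enn2real p) \<partial>N)
      = ennreal (\<bar>k\<bar> powr enn2real p) * (\<integral>\<^sup>+x. ennreal (\<bar>f x\<bar> powr enn2real p) \<partial>N)"
    by (subst nn_integral_cmult[symmetric]) (auto simp: abs_mult powr_mult ennreal_mult)
  also have "\<dots> < \<infinity>" using fin by (simp add: ennreal_mult_less_top)
  finally show ?thesis using False by (auto simp: Lp_def)
qed

lemma Lp_add:
  assumes "f \<in> Lp N p" "g \<in> Lp N p"
  shows "(\<lambda>x. f x + g x) \<in> Lp N p"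
proof (cases "p = \<infinity>")
  case True
  then obtain C D where C: "AE x in N. \<bar>f x\<bar> \<le> C" and D: "AE x in N. \<bar>g x\<bar> \<le> D"
    and [measurable]: "f \<in> borel_measurable N" "g \<in> borel_measurable N"
    using assms by (auto simp: Lp_def)
  have "AE x in N. \<bar>f x + g x\<bar> \<le> C + D"
    using C D by eventually_elim simp
  then show ?thesis using True by (auto simp: Lp_def)
next
  case False
  define r where "r = enn2real p"
  have r: "0 \<le> r" by (simp add: r_def)
  have fin: "(\<integral>\<^sup>+x. ennreal (\<bar>f x\<bar> powr r) \<partial>N) < \<infinity>" "(\<integral>\<^sup>+x. ennreal (\<bar>g x\<bar> powr r) \<partial>N) < \<infinity>"
    and [measurable]: "f \<in> borel_measurable N" "g \<in> borel_measurable N"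
    using assms False by (auto simp: Lp_def r_def)
  have bound: "\<bar>y + z\<bar> powr r \<le> 2 powr r * (\<bar>y\<bar> powr r + \<bar>z\<bar> powr r)" for y z :: real
  proof -
    have "\<bar>y + z\<bar> powr r \<le> (2 * max \<bar>y\<bar> \<bar>z\<bar>) powr r"
      using r by (intro powr_mono2) auto
    also have "\<dots> = 2 powr r * max \<bar>y\<bar> \<bar>z\<bar> powr r" by (simp add: powr_mult)
    also have "\<dots> \<le> 2 powr r * (\<bar>y\<bar> powr r + \<bar>z\<bar> powr r)"
      by (intro mult_left_mono) (auto simp: max_def)
    finally show ?thesis .
  qed
  have "(\<integral>\<^sup>+x. ennreal (\<bar>f x + g x\<bar> powr r) \<partial>N)
      \<le> (\<integral>\<^sup>+x. ennreal (2 powr r) * (ennreal (\<bar>f x\<bar> powr r) + ennreal (\<bar>g x\<bar> powr r)) \<partial>N)"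
    by (intro nn_integral_mono) (simp add: bound flip: ennreal_plus ennreal_mult)
  also have "\<dots> = ennreal (2 powr r) *
      ((\<integral>\<^sup>+x. ennreal (\<bar>f x\<bar> powr r) \<partial>N) + (\<integral>\<^sup>+x. ennreal (\<bar>g x\<bar> powr r) \<partial>N))"
    by (simp add: nn_integral_cmult nn_integral_add)
  also have "\<dots> < \<infinity>" using fin by (simp add: ennreal_mult_less_top)
  finally show ?thesis using False by (auto simp: Lp_def r_def)
qed

lemma Lp_zero: "(\<lambda>x. 0) \<in> Lp N p"
  by (auto simp: Lp_def)

lemma Lp_sum:
  assumes "\<And>i. i \<in> I \<Longrightarrow> f i \<in> Lp N p"
  shows "(\<lambda>x. \<Sum>i\<in>I. f i x) \<in> Lp N p"
  using assms by (induction I rule: infinite_finite_induct) (auto intro: Lp_zero Lp_add)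

text \<open>
  Extension by zero makes \<open>L\<^sub>q(G)\<close> a subspace of \<open>L\<^sub>q\<close> over the whole space, so that kernels living on the
  different sets \<open>G\<^sub>A\<close> and \<open>G\<^sub>B\<close> can be added.
\<close>

lemma Lp_zero_extension:
  assumes G: "G \<in> sets M"
  shows "(\<lambda>s. indicator G s * g s) \<in> Lp M p \<longleftrightarrow> g \<in> Lp (restrict_space M G) p"
proof -
  have G': "G \<inter> space M \<in> sets M" using G by auto
  have powr_ind: "ennreal (\<bar>indicator G s * g s\<bar> powr r) = ennreal (\<bar>g s\<bar> powr r) * indicator G s"
    for s r by (auto simp: indicator_def)
  have "(\<exists>C. AE s in M. \<bar>indicator G s * g s\<bar> \<le> C) \<longleftrightarrow> (\<exists>C. AE s in M. s \<in> G \<longrightarrow> \<bar>g s\<bar> \<le> C)"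
  proof safe
    fix C assume "AE s in M. \<bar>indicator G s * g s\<bar> \<le> C"
    then have "AE s in M. s \<in> G \<longrightarrow> \<bar>g s\<bar> \<le> C" by eventually_elim auto
    then show "\<exists>C. AE s in M. s \<in> G \<longrightarrow> \<bar>g s\<bar> \<le> C" ..
  next
    fix C assume "AE s in M. s \<in> G \<longrightarrow> \<bar>g s\<bar> \<le> C"
    \<comment> \<open>The bound must hold for the value 0 outside \<open>G\<close> too, and \<open>C\<close> may be negative if \<open>G\<close> is null.\<close>
    then have "AE s in M. \<bar>indicator G s * g s\<bar> \<le> max C 0"
      by eventually_elim (auto simp: indicator_def)
    then show "\<exists>C. AE s in M. \<bar>indicator G s * g s\<bar> \<le> C" ..
  qed
  then show ?thesis
    by (simp add: Lp_def borel_measurable_restrict_space_iff[OF G']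
        nn_integral_restrict_space[OF G'] AE_restrict_space_iff[OF G'] powr_ind)
qed

text \<open>
  These are the test functions: they lie in \<open>L\<^sub>p\<close> for every exponent simultaneously.
\<close>

lemma bounded_on_finite_measure_in_Lp:
  assumes "f \<in> borel_measurable M" "S \<in> sets M" "emeasure M S \<noteq> \<infinity>"
    and bd: "\<And>x. \<bar>f x\<bar> \<le> indicator S x"
  shows "f \<in> Lp M p"
proof (cases "p = \<infinity>")
  case True
  have "\<bar>f x\<bar> \<le> 1" for x
    using bd[of x] indicator_le_1[of S x] by (rule order_trans)
  then have "\<exists>C. AE x in M. \<bar>f x\<bar> \<le> C" by (intro exI[of _ 1] AE_I2)
  then show ?thesis using True assms(1) by (auto simp: Lp_def)
next
  case False
  have "\<bar>f x\<bar> powr r \<le> indicator S x" if "r \<ge> 0" for x r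
    using bd[of x] powr_mono2[of r "\<bar>f x\<bar>" 1] that
    by (auto simp: indicator_def split: if_splits)
  then have "(\<integral>\<^sup>+x. ennreal (\<bar>f x\<bar> powr enn2real p) \<partial>M) \<le> (\<integral>\<^sup>+x. indicator S x \<partial>M)"
    by (intro nn_integral_mono) (metis ennreal_indicator ennreal_leI enn2real_nonneg)
  also have "\<dots> < \<infinity>" using assms by (simp add: top.not_eq_extremum)
  finally show ?thesis using False assms(1) by (auto simp: Lp_def)
qed

section \<open>Integrability of products for conjugate exponents\<close>

lemma integrable_mult_ess_bounded:
  fixes f g :: "'a \<Rightarrow> real"
  assumes "f \<in> Lp N \<infinity>" "g \<in> Lp N 1"
  shows "integrable N (\<lambda>x. f x * g x)"
proof -
  obtain C where C: "AE x in N. \<bar>f x\<bar> \<le> C"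
    and [measurable]: "f \<in> borel_measurable N" "g \<in> borel_measurable N"
    using assms by (auto simp: Lp_def)
  have fin: "(\<integral>\<^sup>+x. ennreal \<bar>g x\<bar> \<partial>N) < \<infinity>"
    using assms(2) by (simp add: Lp_def powr_one')
  have "integrable N g" using fin by (intro integrableI_bounded) auto
  then have "integrable N (\<lambda>x. C * g x)" by simp
  then show ?thesis
  proof (rule Bochner_Integration.integrable_bound)
    show "AE x in N. norm (f x * g x) \<le> norm (C * g x)"
      using C by eventually_elim (auto simp: abs_mult intro!: mult_right_mono)
  qed simp
qed

text \<open>
  A crude form of Young's inequality, which suffices for integrability. The larger of the two
  powers alone dominates: if \<open>\<bar>z\<bar>\<^bsup>r'\<^esup> \<le> \<bar>y\<bar>\<^bsup>r\<^esup>\<close> then \<open>\<bar>z\<bar> \<le> \<bar>y\<bar>\<^bsup>r/r'\<^esup> = \<bar>y\<bar>\<^bsup>r-1\<^esup>\<close>.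
\<close>

lemma abs_mult_le_powr_add:
  fixes y z :: real
  assumes r: "1 < r" "1 < r'" and conj: "1 / r + 1 / r' = 1"
  shows "\<bar>y * z\<bar> \<le> \<bar>y\<bar> powr r + \<bar>z\<bar> powr r'"
proof -
  have *: "v * w \<le> v powr s" if "0 \<le> v" "0 \<le> w" "w powr s' \<le> v powr s" "1 < s" "1 < s'" "1 / s + 1 / s' = 1"
    for v w s s' :: real
  proof (cases "v = 0")
    case False
    have "1 / s' = 1 - 1 / s" using that(6) by simp
    then have e: "s * (1 / s') = s - 1" using that(4) by (simp only: right_diff_distrib) simp
    have "w = (w powr s') powr (1 / s')" using that(2,5) by (simp add: powr_powr)
    also have "\<dots> \<le> (v powr s) powr (1 / s')" using that(3,5) by (intro powr_mono2) auto
    also have "\<dots> = v powr (s - 1)" by (simp only: powr_powr e)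
    finally have "v * w \<le> v * v powr (s - 1)" using that(1) by (intro mult_left_mono)
    also have "\<dots> = v powr s" using that(1) by (simp add: powr_mult_base)
    finally show ?thesis .
  qed simp
  show ?thesis
  proof (cases "\<bar>z\<bar> powr r' \<le> \<bar>y\<bar> powr r")
    case True
    then have "\<bar>y\<bar> * \<bar>z\<bar> \<le> \<bar>y\<bar> powr r"
      using r conj by (intro *[of _ _ r']) auto
    then show ?thesis by (simp add: abs_mult add_increasing2)
  next
    case False
    then have "\<bar>z\<bar> * \<bar>y\<bar> \<le> \<bar>z\<bar> powr r'"
      using r conj by (intro *[of _ _ r]) (auto simp: add.commute)
    then show ?thesis by (simp add: abs_mult add_increasing mult.commute)
  qed
qed

text \<open>
  The qualitative part of Hoelder's inequality. An infinite exponent forces the other one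
  to be 1, so the endpoint cases reduce to a bounded factor.
\<close>

lemma Lp_conjugate_integrable:
  assumes pq: "1 \<le> p" "1 \<le> q" "1 / p + 1 / q = 1"
    and "f \<in> Lp N p" "g \<in> Lp N q"
  shows "integrable N (\<lambda>x. f x * g x)"
proof -
  have one: "y = 1" if "1 / y = 1" "1 \<le> y" for y :: ennreal
  proof (cases y rule: ennreal_cases)
    case (real r)
    have "1 \<le> r" using that(2) real by simp
    have "1 / y = ennreal (1 / r)"
      using divide_ennreal[of 1 r] \<open>1 \<le> r\<close> real by simp
    then have "1 / r = 1" using that(1) \<open>1 \<le> r\<close> by simp
    then show ?thesis using real by simp
  next
    case top
    then show ?thesis using that by simp
  qed
  consider "p = \<infinity>" | "q = \<infinity>" | "p \<noteq> \<infinity>" "q \<noteq> \<infinity>" by blast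
  then show ?thesis
  proof cases
    case 1
    then have "q = 1" using pq one by auto
    then show ?thesis using integrable_mult_ess_bounded assms 1 by blast
  next
    case 2
    then have "p = 1" using pq one by auto
    then show ?thesis using integrable_mult_ess_bounded[of g N f] assms 2 by (simp add: mult.commute)
  next
    case 3
    define r r' where "r = enn2real p" and "r' = enn2real q"
    have p: "p = ennreal r" and q: "q = ennreal r'" using 3 by (auto simp: r_def r'_def top.not_eq_extremum)
    have ge: "1 \<le> r" "1 \<le> r'" using pq(1,2) p q by simp_all
    have conj: "1 / r + 1 / r' = 1"
    proof -
      have "1 / p = ennreal (1 / r)" "1 / q = ennreal (1 / r')"
        using divide_ennreal[of 1 r] divide_ennreal[of 1 r'] ge p q by simp_all
      then have "ennreal (1 / r + 1 / r') = 1"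
        using pq(3) ge by (simp add: ennreal_plus)
      then show ?thesis by (simp only: ennreal_eq_1)
    qed
    have gt: "1 < r" "1 < r'" proof -
      have "0 < 1 / r" "0 < 1 / r'" using ge by auto
      then have "1 / r < 1" "1 / r' < 1" using conj by linarith+
      then show "1 < r" "1 < r'" using ge by (auto simp: divide_less_eq)
    qed
    have [measurable]: "f \<in> borel_measurable N" "g \<in> borel_measurable N"
      and fin: "(\<integral>\<^sup>+x. ennreal (\<bar>f x\<bar> powr r) \<partial>N) < \<infinity>" "(\<integral>\<^sup>+x. ennreal (\<bar>g x\<bar> powr r') \<partial>N) < \<infinity>"
      using assms(4,5) 3 by (auto simp: Lp_def r_def r'_def)
    have "(\<integral>\<^sup>+x. ennreal (norm (f x * g x)) \<partial>N)
        \<le> (\<integral>\<^sup>+x. ennreal (\<bar>f x\<bar> powr r) + ennreal (\<bar>g x\<bar> powr r') \<partial>N)"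
      by (intro nn_integral_mono) (simp add: abs_mult_le_powr_add[OF gt conj] flip: ennreal_plus)
    also have "\<dots> < \<infinity>" using fin by (simp add: nn_integral_add)
    finally show ?thesis by (intro integrableI_bounded) auto
  qed
qed

section \<open>Vanishing of finite-rank kernels\<close>

text \<open>
  Testing \<open>g\<close> against its own sign, cut off to a set of finite measure, gives the integral of \<open>\<bar>g\<bar>\<close> over
  that set; countably many such sets cover the space.
\<close>

lemma (in sigma_finite_measure) AE_eq_0_if_orthogonal_to_Lp:
  fixes g :: "'a \<Rightarrow> real"
  assumes [measurable]: "g \<in> borel_measurable M"
    and int: "\<And>x. x \<in> Lp M p \<Longrightarrow> integrable M (\<lambda>s. g s * x s)"
    and zero: "\<And>x. x \<in> Lp M p \<Longrightarrow> (LINT s|M. g s * x s) = 0"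
  shows "AE s in M. g s = 0"
proof -
  obtain S :: "nat \<Rightarrow> 'a set" where S: "range S \<subseteq> sets M" "(\<Union>i. S i) = space M"
    "\<And>i. emeasure M (S i) \<noteq> \<infinity>"
    using sigma_finite by blast
  have "AE s in M. \<bar>g s\<bar> * indicator (S n) s = 0" for n
  proof -
    have [measurable]: "S n \<in> sets M" using S by auto
    \<comment> \<open>The product of this test function with \<open>g\<close> is \<open>\<bar>g\<bar>\<close> on \<open>S n\<close> and 0 elsewhere.\<close>
    let ?x = "\<lambda>s. sgn (g s) * indicator (S n) s"
    have x: "?x \<in> Lp M p"
      by (rule bounded_on_finite_measure_in_Lp[of _ _ "S n"])
        (use S in \<open>auto simp: indicator_def abs_sgn_eq\<close>)
    have eq: "g s * ?x s = \<bar>g s\<bar> * indicator (S n) s" for s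
      by (simp add: mult.assoc[symmetric] abs_sgn)
    show ?thesis
      using int[OF x] zero[OF x] unfolding eq by (subst (asm) integral_nonneg_eq_0_iff_AE) auto
  qed
  then have "AE s in M. \<forall>n. \<bar>g s\<bar> * indicator (S n) s = 0" 
    unfolding AE_all_countable by blast
  moreover have "AE s in M. s \<in> space M" by simp
  ultimately show ?thesis
  proof eventually_elim
    case (elim s)
    then obtain n where "s \<in> S n" using S by blast
    then show ?case using elim(1) by (auto dest: spec[of _ n])
  qed
qed

text \<open>
  Exchanging the quantifiers over \<open>w\<close> and over almost every \<open>t\<close> is possible although \<open>W\<close> may be
  uncountable: for fixed \<open>t\<close> the relation is closed in \<open>w\<close>, so it needs to be checked only on a
  countable dense subset of \<open>W\<close>. The countable index type makes the product topology on vectors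
  metrizable and second countable.
\<close>

lemma AE_forall_linear_relation:
  fixes u :: "'i::countable \<Rightarrow> 'a \<Rightarrow> real" and W :: "('i \<Rightarrow> real) set"
  assumes "\<And>w. w \<in> W \<Longrightarrow> AE t in M. (\<Sum>r\<in>I. u r t * w r) = 0"
  shows "AE t in M. \<forall>w\<in>W. (\<Sum>r\<in>I. u r t * w r) = 0"
proof -
  obtain D where D: "countable D" "D \<subseteq> W" "W \<subseteq> closure D"
    using separable by blast
  have "AE t in M. \<forall>w\<in>D. (\<Sum>r\<in>I. u r t * w r) = 0"
    using assms D by (intro AE_ball_countable') auto
  then show ?thesis
  proof eventually_elim
    case (elim t)
    have "continuous_on UNIV (\<lambda>w::'i \<Rightarrow> real. \<Sum>r\<in>I. u r t * w r)"
      by (intro continuous_intros continuous_on_product_coordinates)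
    then have "closed {w. (\<Sum>r\<in>I. u r t * w r) = 0}"
      by (intro closed_Collect_eq) auto
    then have "closure D \<subseteq> {w. (\<Sum>r\<in>I. u r t * w r) = 0}"
      using elim by (intro closure_minimal) auto
    then show ?case using D by blast
  qed
qed

text \<open>
  For the forward implication \<open>AE_forall_linear_relation\<close> makes the null set of \<open>t\<close> independent of \<open>x\<close>,
  after which each remaining section of the kernel is orthogonal to all of \<open>L\<^sub>p\<close>. The converse is
  Fubini for null sets.
\<close>

lemma finite_rank_kernel_eq_0_iff:
  fixes u v :: "'i::countable \<Rightarrow> 'a \<Rightarrow> real"
  assumes "sigma_finite_measure M" and pq: "1 \<le> p" "1 \<le> q" "1 / p + 1 / q = 1"
    and u: "\<And>r. r \<in> I \<Longrightarrow> u r \<in> borel_measurable M"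
    and v: "\<And>r. r \<in> I \<Longrightarrow> v r \<in> Lp M q"
  shows "(\<forall>x\<in>Lp M p. AE t in M. (\<Sum>r\<in>I. u r t * (LINT s|M. v r s * x s)) = 0) \<longleftrightarrow>
    (AE (t, s) in M \<Otimes>\<^sub>M M. (\<Sum>r\<in>I. u r t * v r s) = 0)"
proof -
  interpret sigma_finite_measure M by fact
  interpret P: pair_sigma_finite M M ..
  have [measurable]: "u r \<in> borel_measurable M" "v r \<in> borel_measurable M" if "r \<in> I" for r
    using u v that by (auto intro: Lp_measurable)
  have int: "integrable M (\<lambda>s. v r s * x s)" if "r \<in> I" "x \<in> Lp M p" for r x
    using Lp_conjugate_integrable[OF pq that(2) v[OF that(1)]] by (simp add: mult.commute)
  have slice: "integrable M (\<lambda>s. (\<Sum>r\<in>I. u r t * v r s) * x s)"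
    "(LINT s|M. (\<Sum>r\<in>I. u r t * v r s) * x s) = (\<Sum>r\<in>I. u r t * (LINT s|M. v r s * x s))"
    if "x \<in> Lp M p" for x t
  proof -
    have eq: "(\<Sum>r\<in>I. u r t * v r s) * x s = (\<Sum>r\<in>I. u r t * (v r s * x s))" for s
      by (simp add: sum_distrib_right mult.assoc)
    show "integrable M (\<lambda>s. (\<Sum>r\<in>I. u r t * v r s) * x s)"
      unfolding eq using int that by auto
    show "(LINT s|M. (\<Sum>r\<in>I. u r t * v r s) * x s) = (\<Sum>r\<in>I. u r t * (LINT s|M. v r s * x s))"
      unfolding eq using int that by (subst Bochner_Integration.integral_sum) auto
  qed
  show ?thesis
  proof
    assume L: "\<forall>x\<in>Lp M p. AE t in M. (\<Sum>r\<in>I. u r t * (LINT s|M. v r s * x s)) = 0"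
    have "AE t in M. \<forall>w\<in>(\<lambda>x r. LINT s|M. v r s * x s) ` Lp M p. (\<Sum>r\<in>I. u r t * w r) = 0"
      using L by (intro AE_forall_linear_relation) auto
    then have "AE t in M. AE s in M. (\<Sum>r\<in>I. u r t * v r s) = 0"
    proof eventually_elim
      case (elim t)
      show ?case
        using elim slice by (intro AE_eq_0_if_orthogonal_to_Lp[where p = p]) auto
    qed
    then show "AE (t, s) in M \<Otimes>\<^sub>M M. (\<Sum>r\<in>I. u r t * v r s) = 0"
      by (intro P.AE_pair_measure) auto
  next
    assume "AE (t, s) in M \<Otimes>\<^sub>M M. (\<Sum>r\<in>I. u r t * v r s) = 0"
    from P.AE_pair[OF this] have *: "AE t in M. AE s in M. (\<Sum>r\<in>I. u r t * v r s) = 0" by simp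
    show "\<forall>x\<in>Lp M p. AE t in M. (\<Sum>r\<in>I. u r t * (LINT s|M. v r s * x s)) = 0"
    proof
      fix x assume x: "x \<in> Lp M p"
      show "AE t in M. (\<Sum>r\<in>I. u r t * (LINT s|M. v r s * x s)) = 0"
        using *
      proof eventually_elim
        case (elim t)
        then have "(LINT s|M. (\<Sum>r\<in>I. u r t * v r s) * x s) = 0"
          by (intro integral_eq_zero_AE) (auto elim: eventually_mono)
        then show ?case using slice(2)[OF x] by simp
      qed
    qed
  qed
qed

section \<open>The pairing and multi-index sums\<close>

text \<open>
  Multi-indices are extended at their last entry: the first entry, which selects the function
  \<open>a\<^bsub>i(1)\<^esub>\<close>, then stays untouched in the induction over powers of an operator.
\<close>

lemma sum_multi_index_Suc:
  fixes X :: "(nat \<Rightarrow> nat) \<Rightarrow> real"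
  shows "(\<Sum>i\<in>{1..Suc j} \<rightarrow>\<^sub>E S. X i) = (\<Sum>i\<in>{1..j} \<rightarrow>\<^sub>E S. \<Sum>k\<in>S. X (i(Suc j := k)))"
proof -
  have *: "{1..Suc j} = insert (Suc j) {1..j}" by auto
  have "(\<Sum>i\<in>{1..Suc j} \<rightarrow>\<^sub>E S. X i) = (\<Sum>(k, i)\<in>S \<times> ({1..j} \<rightarrow>\<^sub>E S). X (i(Suc j := k)))"
    unfolding * PiE_insert_eq
    by (subst sum.reindex[OF inj_combinator]) (auto simp: case_prod_unfold)
  also have "\<dots> = (\<Sum>i\<in>{1..j} \<rightarrow>\<^sub>E S. \<Sum>k\<in>S. X (i(Suc j := k)))"
    by (simp add: sum.swap[of _ S] flip: sum.cartesian_product)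
  finally show ?thesis .
qed

lemma sum_swap_inner:
  fixes X :: "'i \<Rightarrow> 'j \<Rightarrow> 'k \<Rightarrow> real"
  shows "(\<Sum>l\<in>I. \<Sum>m\<in>S l. \<Sum>k\<in>J. X l m k) = (\<Sum>k\<in>J. \<Sum>l\<in>I. \<Sum>m\<in>S l. X l m k)"
  unfolding sum.swap[of _ J "S _"] by (rule sum.swap)

lemma Q_commute: "Q M G x y = Q M G y x"
  by (simp add: Q_def mult.commute)

lemma Q_zero_extension: "Q M G g x = (LINT s|M. (indicator G s * g s) * x s)"
  by (simp add: Q_def set_lebesgue_integral_def mult.assoc)

text \<open>
  Bilinearity of \<open>Q\<close> on \<open>L\<^sub>q(G) \<times> L\<^sub>p\<close>. Since the integral of a non-integrable function is 0 by convention,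
  additivity rests on the integrability provided by conjugate exponents.
\<close>

locale conjugate_exponents =
  fixes M :: "'a measure" and p q :: ennreal
  assumes exponents: "1 \<le> p" "1 \<le> q" "1 / p + 1 / q = 1"
begin

lemma pairing_integrable:
  assumes "G \<in> sets M" "g \<in> Lp (restrict_space M G) q" "x \<in> Lp M p"
  shows "set_integrable M G (\<lambda>s. g s * x s)"
proof -
  have "integrable M (\<lambda>s. x s * (indicator G s * g s))"
    using assms Lp_zero_extension by (intro Lp_conjugate_integrable[OF exponents]) blast+
  then show ?thesis by (simp add: set_integrable_def mult_ac)
qed

lemma Q_sum_right:
  assumes "G \<in> sets M" "g \<in> Lp (restrict_space M G) q" "\<And>r. r \<in> I \<Longrightarrow> y r \<in> Lp M p"
  shows "Q M G g (\<lambda>s. \<Sum>r\<in>I. k r * y r s) = (\<Sum>r\<in>I. k r * Q M G g (y r))"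
proof -
  have int: "integrable M (\<lambda>s. indicator G s * (g s * y r s))" if "r \<in> I" for r
    using pairing_integrable[OF assms(1,2) assms(3)[OF that]] by (simp add: set_integrable_def)
  have "Q M G g (\<lambda>s. \<Sum>r\<in>I. k r * y r s) = (LINT s|M. (\<Sum>r\<in>I. k r * (indicator G s * (g s * y r s))))"
    by (simp add: Q_def set_lebesgue_integral_def sum_distrib_left mult_ac)
  also have "\<dots> = (\<Sum>r\<in>I. LINT s|M. k r * (indicator G s * (g s * y r s)))"
    using int by (intro Bochner_Integration.integral_sum) auto
  also have "\<dots> = (\<Sum>r\<in>I. k r * Q M G g (y r))"
    by (simp add: Q_def set_lebesgue_integral_def)
  finally show ?thesis .
qed

lemma Q_sum_left:
  assumes "G \<in> sets M" "x \<in> Lp M p" "\<And>r. r \<in> I \<Longrightarrow> g r \<in> Lp (restrict_space M G) q"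
  shows "Q M G (\<lambda>s. \<Sum>r\<in>I. k r * g r s) x = (\<Sum>r\<in>I. k r * Q M G (g r) x)"
proof -
  have int: "integrable M (\<lambda>s. indicator G s * (g r s * x s))" if "r \<in> I" for r
    using pairing_integrable[OF assms(1) assms(3)[OF that] assms(2)] by (simp add: set_integrable_def)
  have "Q M G (\<lambda>s. \<Sum>r\<in>I. k r * g r s) x = (LINT s|M. (\<Sum>r\<in>I. k r * (indicator G s * (g r s * x s))))"
    by (simp add: Q_def set_lebesgue_integral_def sum_distrib_left sum_distrib_right mult_ac)
  also have "\<dots> = (\<Sum>r\<in>I. LINT s|M. k r * (indicator G s * (g r s * x s)))"
    using int by (intro Bochner_Integration.integral_sum) auto
  also have "\<dots> = (\<Sum>r\<in>I. k r * Q M G (g r) x)"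
    by (simp add: Q_def set_lebesgue_integral_def)
  finally show ?thesis .
qed

lemma Q_cong_AE:
  assumes "G \<in> sets M" "g \<in> Lp (restrict_space M G) q" "x \<in> Lp M p" "y \<in> Lp M p"
    and "AE t in M. x t = y t"
  shows "Q M G g x = Q M G g y"
proof -
  have [measurable]: "(\<lambda>s. indicator G s * g s) \<in> borel_measurable M" "x \<in> borel_measurable M" "y \<in> borel_measurable M"
    using assms Lp_zero_extension Lp_measurable by blast+
  show ?thesis unfolding Q_zero_extension
    using assms(5) by (intro integral_cong_AE) (auto elim!: eventually_mono)
qed

end

section \<open>Operators with separated kernels\<close>

text \<open>
  Both \<open>A\<close> and \<open>B\<close> are instances. The operator acts on representatives, and its values are
  known only up to null sets; \<open>T_AE\<close> and \<open>pairing_T\<close> are the forms in which the kernel is used.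
\<close>

locale separated_operator = conjugate_exponents +
  fixes G :: "'a set" and L :: nat and a c :: "nat \<Rightarrow> 'a \<Rightarrow> real"
    and T :: "('a \<Rightarrow> real) \<Rightarrow> 'a \<Rightarrow> real"
  assumes G: "G \<in> sets M"
    and a: "\<And>i. i \<in> {1..L} \<Longrightarrow> a i \<in> Lp M p"
    and c: "\<And>i. i \<in> {1..L} \<Longrightarrow> c i \<in> Lp (restrict_space M G) q"
    and T: "T \<in> Lp M p \<rightarrow> Lp M p"
    and T_kernel: "\<And>x. x \<in> Lp M p \<Longrightarrow>
           AE t in M. T x t = (LINT s:G|M. (\<Sum>i=1..L. a i t * c i s * x s))"
begin

lemma T_Lp: "x \<in> Lp M p \<Longrightarrow> T x \<in> Lp M p"
  using T by blast

lemma T_AE: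
  assumes x: "x \<in> Lp M p"
  shows "AE t in M. T x t = (\<Sum>i=1..L. Q M G (c i) x * a i t)"
  using T_kernel[OF x]
proof eventually_elim
  case (elim t)
  have "(LINT s:G|M. (\<Sum>i=1..L. a i t * c i s * x s)) = Q M G (\<lambda>s. \<Sum>i=1..L. a i t * c i s) x"
    by (simp add: Q_def sum_distrib_right)
  also have "\<dots> = (\<Sum>i=1..L. a i t * Q M G (c i) x)"
    using c by (intro Q_sum_left[OF G x]) auto
  finally show ?case using elim by (simp add: mult.commute)
qed

lemma pairing_T:
  assumes G': "G' \<in> sets M" "g \<in> Lp (restrict_space M G') q" and x: "x \<in> Lp M p"
  shows "Q M G' g (T x) = (\<Sum>i=1..L. Q M G (c i) x * Q M G' g (a i))"
proof -
  have "Q M G' g (T x) = Q M G' g (\<lambda>t. \<Sum>i=1..L. Q M G (c i) x * a i t)"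
    using T_AE[OF x] T_Lp[OF x] a by (intro Q_cong_AE[OF G']) (auto intro!: Lp_sum Lp_cmult)
  also have "\<dots> = (\<Sum>i=1..L. Q M G (c i) x * Q M G' g (a i))"
    using a by (intro Q_sum_right[OF G']) auto
  finally show ?thesis .
qed

lemma funpow_Lp: "x \<in> Lp M p \<Longrightarrow> (T ^^ j) x \<in> Lp M p"
  by (induction j) (auto intro: T_Lp)

text \<open>
  The induction peels off the innermost application, \<open>T\<^sup>j\<^sup>+\<^sup>1 x = T\<^sup>j (T x)\<close>: the pairing
  \<open>Q\<^sub>G(c\<^bsub>i(j)\<^esub>, T x)\<close> expands into the next factor of \<open>\<gamma>\<close> and a pairing of \<open>x\<close> with the new last \<open>c\<close>.
\<close>

lemma funpow_AE:
  assumes "x \<in> Lp M p"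
  shows "AE t in M. (T ^^ Suc j) x t =
    (\<Sum>i\<in>{1..Suc j} \<rightarrow>\<^sub>E {1..L}. gam M G a c (Suc j) i * Q M G (c (i (Suc j))) x * a (i 1) t)"
  using assms
proof (induction j arbitrary: x)
  case 0
  show ?case using T_AE[OF 0] unfolding sum_multi_index_Suc by (simp add: gam_def)
next
  case (Suc j)
  have "(T ^^ Suc (Suc j)) x = (T ^^ Suc j) (T x)" by (simp add: funpow_swap1)
  moreover have "gam M G a c (Suc j) i * Q M G (c (i (Suc j))) (T x) * a (i 1) t
      = (\<Sum>k=1..L. gam M G a c (Suc (Suc j)) (i(Suc (Suc j) := k)) * Q M G (c k) x * a (i 1) t)"
    if i: "i \<in> {1..Suc j} \<rightarrow>\<^sub>E {1..L}" for i t
  proof -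
    have "i (Suc j) \<in> {1..L}" using i by (auto dest: PiE_mem)
    then have "Q M G (c (i (Suc j))) (T x) = (\<Sum>k=1..L. Q M G (c k) x * Q M G (a k) (c (i (Suc j))))"
      using pairing_T[OF G c Suc.prems] by (simp add: Q_commute)
    moreover have "gam M G a c (Suc (Suc j)) (i(Suc (Suc j) := k))
        = gam M G a c (Suc j) i * Q M G (a k) (c (i (Suc j)))" for k
      by (simp add: gam_def prod.atLeastLessThan_Suc)
    ultimately show ?thesis by (simp add: sum_distrib_left sum_distrib_right mult_ac)
  qed
  ultimately show ?case
    using Suc.IH[OF T_Lp[OF Suc.prems]] by (subst sum_multi_index_Suc) simp
qed

text \<open>
  The coefficient sequence may end in zeros, so its length can exceed the degree of the polynomial.
\<close>

lemma poly_op_eq: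
  assumes "F = (\<Sum>j=0..n. monom (f j) j)"
  shows "poly_op F T x t = (\<Sum>j=0..n. f j * (T ^^ j) x t)"
proof -
  have cf: "coeff F j = (if j \<le> n then f j else 0)" for j
    by (auto simp: assms coeff_sum)
  have "degree F \<le> n" by (rule degree_le) (simp add: cf)
  have "poly_op F T x t = (\<Sum>j\<le>n. coeff F j * (T ^^ j) x t)"
    unfolding poly_op_def using \<open>degree F \<le> n\<close>
    by (intro sum.mono_neutral_left) (auto simp: coeff_eq_0)
  then show ?thesis by (simp add: cf atLeast0AtMost)
qed

lemma poly_op_Lp:
  assumes "x \<in> Lp M p"
  shows "poly_op F T x \<in> Lp M p"
  unfolding poly_op_def using assms by (intro Lp_sum Lp_cmult funpow_Lp)

lemma poly_op_AE:
  assumes F: "F = (\<Sum>j=0..n. monom (f j) j)" and x: "x \<in> Lp M p"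
  shows "AE t in M. poly_op F T x t = f 0 * x t +
    (\<Sum>j=1..n. \<Sum>i\<in>{1..j} \<rightarrow>\<^sub>E {1..L}. f j * gam M G a c j i * Q M G (c (i j)) x * a (i 1) t)"
proof -
  have "AE t in M. \<forall>j\<in>{1..n}. (T ^^ j) x t =
    (\<Sum>i\<in>{1..j} \<rightarrow>\<^sub>E {1..L}. gam M G a c j i * Q M G (c (i j)) x * a (i 1) t)"
  proof (intro AE_ball_countable')
    fix j assume "j \<in> {1..n}"
    then show "AE t in M. (T ^^ j) x t =
      (\<Sum>i\<in>{1..j} \<rightarrow>\<^sub>E {1..L}. gam M G a c j i * Q M G (c (i j)) x * a (i 1) t)"
      using funpow_AE[OF x, of "j - 1"] by simp
  qed simp
  then show ?thesis
  proof eventually_elim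
    case (elim t)
    have "poly_op F T x t = f 0 * x t + (\<Sum>j=1..n. f j * (T ^^ j) x t)"
      by (simp add: poly_op_eq[OF F] sum.atLeast_Suc_atMost)
    then show ?case using elim by (simp add: sum_distrib_left mult.assoc)
  qed
qed

text \<open>
  In the composition \<open>B F(A)\<close>, the operator \<open>F(A)\<close> enters only through pairings with the functions \<open>e\<^sub>k\<close>.
  Moving the sum into the first argument exhibits the transposed kernel function on \<open>G\<close>,
  which is the form that \<open>finite_rank_kernel_eq_0_iff\<close> requires.
\<close>

lemma pairing_poly_op:
  assumes F: "F = (\<Sum>j=0..n. monom (f j) j)" and x: "x \<in> Lp M p"
    and G': "G' \<in> sets M" "g \<in> Lp (restrict_space M G') q"
  shows "Q M G' g (poly_op F T x) = f 0 * Q M G' g x +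
    Q M G (\<lambda>s. \<Sum>j=1..n. \<Sum>i\<in>{1..j} \<rightarrow>\<^sub>E {1..L}. f j * gam M G a c j i * Q M G' g (a (i 1)) * c (i j) s) x"
proof -
  \<comment> \<open>Flattening the double sum to one index set lets the pairing be linear in a single step.\<close>
  define I where "I = (SIGMA j:{1..n}. {1..j} \<rightarrow>\<^sub>E {1..L})"
  have I: "i j \<in> {1..L}" "i 1 \<in> {1..L}" if "(j, i) \<in> I" for j i
    using that by (auto simp: I_def dest: PiE_mem)
  have Sig: "(\<Sum>j=1..n. \<Sum>i\<in>{1..j} \<rightarrow>\<^sub>E {1..L}. X j i) = (\<Sum>(j, i)\<in>I. X j i)" for X :: "nat \<Rightarrow> (nat \<Rightarrow> nat) \<Rightarrow> real"
    unfolding I_def by (intro sum.Sigma) (auto intro!: finite_PiE)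
  define K where "K = (\<lambda>(j, i). f j * gam M G a c j i * Q M G (c (i j)) x)"
  define u where "u = (\<lambda>(j :: nat, i :: nat \<Rightarrow> nat). a (i 1))"
  have u: "u r \<in> Lp M p" if "r \<in> I" for r
    using that a I by (cases r) (simp add: u_def)
  have "AE t in M. poly_op F T x t = f 0 * x t + (\<Sum>r\<in>I. K r * u r t)"
    using poly_op_AE[OF F x] unfolding Sig by (simp add: K_def u_def case_prod_unfold)
  then have "Q M G' g (poly_op F T x) = Q M G' g (\<lambda>t. f 0 * x t + (\<Sum>r\<in>I. K r * u r t))"
    using u by (intro Q_cong_AE[OF G' poly_op_Lp[OF x]]) (auto intro!: Lp_add Lp_cmult Lp_sum x)
  \<comment> \<open>The two summands are written as a sum over booleans so that \<open>Q_sum_right\<close> applies.\<close>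
  also have "(\<lambda>t. f 0 * x t + (\<Sum>r\<in>I. K r * u r t)) =
      (\<lambda>t. \<Sum>b\<in>{True, False}. (if b then f 0 else 1) * (if b then x else (\<lambda>t. \<Sum>r\<in>I. K r * u r t)) t)"
    by simp
  also have "Q M G' g \<dots> = f 0 * Q M G' g x + Q M G' g (\<lambda>t. \<Sum>r\<in>I. K r * u r t)"
    using u by (subst Q_sum_right[OF G']) (auto intro!: Lp_cmult Lp_sum x)
  also have "Q M G' g (\<lambda>t. \<Sum>r\<in>I. K r * u r t) = (\<Sum>r\<in>I. K r * Q M G' g (u r))"
    using u by (intro Q_sum_right[OF G'])
  also have "\<dots> = (\<Sum>(j, i)\<in>I. (f j * gam M G a c j i * Q M G' g (a (i 1))) * Q M G (c (i j)) x)"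
    by (simp add: K_def u_def case_prod_unfold mult_ac)
  also have "\<dots> = Q M G (\<lambda>s. \<Sum>r\<in>I. (case r of (j, i) \<Rightarrow> f j * gam M G a c j i * Q M G' g (a (i 1)))
      * (case r of (j, i) \<Rightarrow> c (i j)) s) x"
    using c I by (subst Q_sum_left[OF G x]) (auto simp: case_prod_unfold)
  finally show ?thesis unfolding Sig by (simp add: case_prod_unfold)
qed

end

section \<open>The commutation relation\<close>

theorem theorem1:
  fixes M :: "'a measure" and p q :: ennreal
    and A B :: "('a \<Rightarrow> real) \<Rightarrow> ('a \<Rightarrow> real)"
    and G\<^sub>A G\<^sub>B G :: "'a set" and l\<^sub>A l\<^sub>B n\<^sub>f n\<^sub>h :: nat
    and a b c e :: "nat \<Rightarrow> 'a \<Rightarrow> real"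
    and f h :: "nat \<Rightarrow> real" and F H :: "real poly"
    and \<gamma> :: "nat \<Rightarrow> (nat \<Rightarrow> nat) \<Rightarrow> real"
  assumes "sigma_finite_measure M"
    and "1 \<le> p" and "1 \<le> q" and "1 / p + 1 / q = 1"
    and "G\<^sub>A \<in> sets M" and "G\<^sub>B \<in> sets M"
    and "1 \<le> l\<^sub>A" and "1 \<le> l\<^sub>B"
    and "\<And>i. i \<in> {1..l\<^sub>A} \<Longrightarrow> a i \<in> Lp M p"
    and "\<And>j. j \<in> {1..l\<^sub>B} \<Longrightarrow> b j \<in> Lp M p"
    and "\<And>i. i \<in> {1..l\<^sub>A} \<Longrightarrow> c i \<in> Lp (restrict_space M G\<^sub>A) q"
    and "\<And>j. j \<in> {1..l\<^sub>B} \<Longrightarrow> e j \<in> Lp (restrict_space M G\<^sub>B) q"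
    and "A \<in> Lp M p \<rightarrow> Lp M p" and "B \<in> Lp M p \<rightarrow> Lp M p"
    and "\<And>x. x \<in> Lp M p \<Longrightarrow>
           AE t in M. A x t = (LINT s:G\<^sub>A|M. (\<Sum>i=1..l\<^sub>A. a i t * c i s * x s))"
    and "\<And>x. x \<in> Lp M p \<Longrightarrow>
           AE t in M. B x t = (LINT s:G\<^sub>B|M. (\<Sum>j=1..l\<^sub>B. b j t * e j s * x s))"
    and "\<exists>x\<in>Lp M p. \<not> (AE t in M. A x t = 0)"
    and "\<exists>x\<in>Lp M p. \<not> (AE t in M. B x t = 0)"
    and "F = (\<Sum>j=0..n\<^sub>f. monom (f j) j)"
    and "H = (\<Sum>l=0..n\<^sub>h. monom (h l) l)"
    and "G = G\<^sub>A \<inter> G\<^sub>B"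
    and "\<gamma> = gam M G\<^sub>A a c"
  shows "(\<forall>x\<in>Lp M p. AE t in M. poly_op H A (B x) t = B (poly_op F A x) t) \<longleftrightarrow>
    (AE (t, s) in M \<Otimes>\<^sub>M M. (t, s) \<in> space M \<times> G \<longrightarrow>
       (h 0 - f 0) * (\<Sum>k=1..l\<^sub>B. b k t * e k s)
       + (\<Sum>l=1..n\<^sub>h. \<Sum>k=1..l\<^sub>B. \<Sum>m\<in>{1..l} \<rightarrow>\<^sub>E {1..l\<^sub>A}.
            h l * \<gamma> l m * a (m 1) t * Q M G\<^sub>A (b k) (c (m l)) * e k s)
       = (\<Sum>k=1..l\<^sub>B. \<Sum>j=1..n\<^sub>f. \<Sum>i\<in>{1..j} \<rightarrow>\<^sub>E {1..l\<^sub>A}.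
            f j * b k t * Q M G\<^sub>B (e k) (a (i 1)) * \<gamma> j i * c (i j) s)) \<and>
    (AE (t, s) in M \<Otimes>\<^sub>M M. (t, s) \<in> space M \<times> (G\<^sub>A - G) \<longrightarrow>
       (\<Sum>k=1..l\<^sub>B. \<Sum>j=1..n\<^sub>f. \<Sum>i\<in>{1..j} \<rightarrow>\<^sub>E {1..l\<^sub>A}.
            f j * b k t * Q M G\<^sub>B (e k) (a (i 1)) * \<gamma> j i * c (i j) s) = 0) \<and>
    (AE (t, s) in M \<Otimes>\<^sub>M M. (t, s) \<in> space M \<times> (G\<^sub>B - G) \<longrightarrow>
       (f 0 - h 0) * (\<Sum>k=1..l\<^sub>B. b k t * e k s)
       = (\<Sum>l=1..n\<^sub>h. \<Sum>k=1..l\<^sub>B. \<Sum>m\<in>{1..l} \<rightarrow>\<^sub>E {1..l\<^sub>A}.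
            h l * \<gamma> l m * Q M G\<^sub>A (b k) (c (m l)) * a (m 1) t * e k s))"
proof -
  interpret A: separated_operator M p q G\<^sub>A l\<^sub>A a c A
    using assms by unfold_locales auto
  interpret B: separated_operator M p q G\<^sub>B l\<^sub>B b e B
    using assms by unfold_locales auto
  define P where "P t s = (\<Sum>k=1..l\<^sub>B. b k t * e k s)" for t s
  define R where "R t s = (\<Sum>l=1..n\<^sub>h. \<Sum>k=1..l\<^sub>B. \<Sum>m\<in>{1..l} \<rightarrow>\<^sub>E {1..l\<^sub>A}.
      h l * \<gamma> l m * a (m 1) t * Q M G\<^sub>A (b k) (c (m l)) * e k s)" for t s
  define S where "S t s = (\<Sum>k=1..l\<^sub>B. \<Sum>j=1..n\<^sub>f. \<Sum>i\<in>{1..j} \<rightarrow>\<^sub>E {1..l\<^sub>A}.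
      f j * b k t * Q M G\<^sub>B (e k) (a (i 1)) * \<gamma> j i * c (i j) s)" for t s
  \<comment> \<open>\<open>\<alpha> k\<close> is \<open>H(A) b\<^sub>k\<close>, and \<open>\<beta> k\<close> is the transpose of \<open>F(A) - f\<^sub>0\<close> applied to \<open>e\<^sub>k\<close>. Thus
      \<open>H(A)B - BF(A)\<close> has the kernel \<open>\<Sum>\<^sub>k (\<alpha>\<^sub>k - f\<^sub>0 b\<^sub>k)(t) e\<^sub>k(s)\<close> on \<open>G\<^sub>B\<close> minus \<open>\<Sum>\<^sub>k b\<^sub>k(t) \<beta>\<^sub>k(s)\<close> on \<open>G\<^sub>A\<close>.
      The two families of terms are indexed by a disjoint sum.\<close>
  define \<alpha> where "\<alpha> k t = h 0 * b k t + (\<Sum>l=1..n\<^sub>h. \<Sum>m\<in>{1..l} \<rightarrow>\<^sub>E {1..l\<^sub>A}.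
      h l * \<gamma> l m * Q M G\<^sub>A (b k) (c (m l)) * a (m 1) t)" for k t
  define \<beta> where "\<beta> k s = (\<Sum>j=1..n\<^sub>f. \<Sum>i\<in>{1..j} \<rightarrow>\<^sub>E {1..l\<^sub>A}.
      f j * \<gamma> j i * Q M G\<^sub>B (e k) (a (i 1)) * c (i j) s)" for k s
  define u where "u = case_sum (\<lambda>k t. \<alpha> k t - f 0 * b k t) b"
  \<comment> \<open>The sign is written as a factor so that membership in \<open>L\<^sub>q\<close> follows from \<open>Lp_cmult\<close>.\<close>
  define v where "v = case_sum (\<lambda>k s. indicator G\<^sub>B s * e k s) (\<lambda>k s. indicator G\<^sub>A s * (- 1 * \<beta> k s))"
  let ?I = "{1..l\<^sub>B} <+> {1..l\<^sub>B}"

  have multi_index: "i j \<in> {1..l\<^sub>A}" "i 1 \<in> {1..l\<^sub>A}" if "j \<in> {1..n}" "i \<in> {1..j} \<rightarrow>\<^sub>E {1..l\<^sub>A}" for i and j n :: nat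
    using that by (auto dest: PiE_mem)
  have \<alpha>_Lp: "\<alpha> k \<in> Lp M p" if "k \<in> {1..l\<^sub>B}" for k
    unfolding \<alpha>_def using that multi_index by (intro Lp_add Lp_cmult Lp_sum A.a B.a)
  have \<beta>_Lp: "\<beta> k \<in> Lp (restrict_space M G\<^sub>A) q" for k
    unfolding \<beta>_def using multi_index by (intro Lp_cmult Lp_sum A.c)
  have "u r \<in> borel_measurable M \<and> v r \<in> Lp M q" if "r \<in> ?I" for r
  proof (cases r)
    case (Inl k)
    then have k: "k \<in> {1..l\<^sub>B}" using that by auto
    have [measurable]: "\<alpha> k \<in> borel_measurable M" "b k \<in> borel_measurable M"
      using \<alpha>_Lp[OF k] B.a[OF k] by (auto dest: Lp_measurable)
    show ?thesis
      using B.c[OF k] by (simp add: Inl u_def v_def Lp_zero_extension B.G)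
  next
    case (Inr k)
    then have k: "k \<in> {1..l\<^sub>B}" using that by auto
    have "v r \<in> Lp M q"
      unfolding Inr v_def sum.case Lp_zero_extension[OF A.G] by (intro Lp_cmult \<beta>_Lp)
    then show ?thesis using Lp_measurable[OF B.a[OF k]] by (simp add: Inr u_def)
  qed
  then have u_meas: "\<And>r. r \<in> ?I \<Longrightarrow> u r \<in> borel_measurable M" and v_Lp: "\<And>r. r \<in> ?I \<Longrightarrow> v r \<in> Lp M q"
    by auto

  have kernel: "(\<Sum>r\<in>?I. u r t * v r s)
      = indicator G\<^sub>B s * ((h 0 - f 0) * P t s + R t s) - indicator G\<^sub>A s * S t s" for t s
  proof -
    have "(\<Sum>k=1..l\<^sub>B. (\<alpha> k t - f 0 * b k t) * e k s) = (h 0 - f 0) * P t s + R t s"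
      unfolding R_def sum.swap[of _ "{1..l\<^sub>B}" "{1..n\<^sub>h}"]
      by (simp add: P_def \<alpha>_def sum_distrib_left sum_distrib_right algebra_simps
          flip: sum.distrib sum_subtractf)
    moreover have "(\<Sum>k=1..l\<^sub>B. b k t * \<beta> k s) = S t s"
      by (simp add: S_def \<beta>_def sum_distrib_left mult_ac)
    moreover have "(\<Sum>r\<in>?I. u r t * v r s) = indicator G\<^sub>B s * (\<Sum>k=1..l\<^sub>B. (\<alpha> k t - f 0 * b k t) * e k s)
        - indicator G\<^sub>A s * (\<Sum>k=1..l\<^sub>B. b k t * \<beta> k s)"
      by (simp add: sum.Plus u_def v_def sum_distrib_left sum_negf mult_ac)
    ultimately show ?thesis by simp
  qed

  have commutator: "(AE t in M. poly_op H A (B x) t = B (poly_op F A x) t) \<longleftrightarrow>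
      (AE t in M. (\<Sum>r\<in>?I. u r t * (LINT s|M. v r s * x s)) = 0)" if x: "x \<in> Lp M p" for x
  proof -
    have Bx: "B x \<in> Lp M p" and FAx: "poly_op F A x \<in> Lp M p"
      using x by (auto intro: B.T_Lp A.poly_op_Lp)
    have v_int: "(\<Sum>r\<in>?I. u r t * (LINT s|M. v r s * x s)) =
        (\<Sum>k=1..l\<^sub>B. (\<alpha> k t - f 0 * b k t) * Q M G\<^sub>B (e k) x) - (\<Sum>k=1..l\<^sub>B. b k t * Q M G\<^sub>A (\<beta> k) x)" for t
      by (simp add: sum.Plus u_def v_def Q_zero_extension sum_negf)
    have cB: "Q M G\<^sub>A (c (m l)) (B x) = (\<Sum>k=1..l\<^sub>B. Q M G\<^sub>B (e k) x * Q M G\<^sub>A (b k) (c (m l)))"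
      if "l \<in> {1..n\<^sub>h}" "m \<in> {1..l} \<rightarrow>\<^sub>E {1..l\<^sub>A}" for l m
      using B.pairing_T[OF A.G A.c x] multi_index(1)[OF that] by (simp add: Q_commute)
    have eF: "Q M G\<^sub>B (e k) (poly_op F A x) = f 0 * Q M G\<^sub>B (e k) x + Q M G\<^sub>A (\<beta> k) x"
      if "k \<in> {1..l\<^sub>B}" for k
      using A.pairing_poly_op[OF assms(19) x B.G B.c[OF that]] by (simp add: \<beta>_def[abs_def] assms(22))
    have "AE t in M. poly_op H A (B x) t - B (poly_op F A x) t
        = (\<Sum>r\<in>?I. u r t * (LINT s|M. v r s * x s))"
      using A.poly_op_AE[OF assms(20) Bx] B.T_AE[OF x] B.T_AE[OF FAx]
    proof eventually_elim
      case (elim t)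
      have "poly_op H A (B x) t = h 0 * (\<Sum>k=1..l\<^sub>B. Q M G\<^sub>B (e k) x * b k t) +
          (\<Sum>l=1..n\<^sub>h. \<Sum>m\<in>{1..l} \<rightarrow>\<^sub>E {1..l\<^sub>A}. \<Sum>k=1..l\<^sub>B.
            Q M G\<^sub>B (e k) x * (h l * \<gamma> l m * Q M G\<^sub>A (b k) (c (m l)) * a (m 1) t))"
        unfolding elim(1) elim(2) assms(22)
        by (intro arg_cong2[where f = "(+)"] sum.cong refl)
          (simp only: cB sum_distrib_left sum_distrib_right mult_ac)
      also have "\<dots> = (\<Sum>k=1..l\<^sub>B. \<alpha> k t * Q M G\<^sub>B (e k) x)"
        unfolding sum_swap_inner
        by (simp add: \<alpha>_def sum_distrib_left sum_distrib_right algebra_simps flip: sum.distrib)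
      finally have "poly_op H A (B x) t = (\<Sum>k=1..l\<^sub>B. \<alpha> k t * Q M G\<^sub>B (e k) x)" .
      moreover have "B (poly_op F A x) t
          = (\<Sum>k=1..l\<^sub>B. f 0 * b k t * Q M G\<^sub>B (e k) x + b k t * Q M G\<^sub>A (\<beta> k) x)"
        unfolding elim(3) by (intro sum.cong refl) (simp only: eF algebra_simps)
      ultimately show ?case
        unfolding v_int by (simp add: left_diff_distrib sum_subtractf sum.distrib)
    qed
    then have "AE t in M. (poly_op H A (B x) t = B (poly_op F A x) t) \<longleftrightarrow>
        (\<Sum>r\<in>?I. u r t * (LINT s|M. v r s * x s)) = 0"
      by eventually_elim auto
    then show ?thesis by (auto elim: eventually_rev_mp)
  qed
  have "(\<forall>x\<in>Lp M p. AE t in M. poly_op H A (B x) t = B (poly_op F A x) t) \<longleftrightarrow>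
      (\<forall>x\<in>Lp M p. AE t in M. (\<Sum>r\<in>?I. u r t * (LINT s|M. v r s * x s)) = 0)"
    using commutator by (intro ball_cong refl)
  also have "\<dots> \<longleftrightarrow> (AE (t, s) in M \<Otimes>\<^sub>M M. (\<Sum>r\<in>?I. u r t * v r s) = 0)"
    using u_meas v_Lp by (intro finite_rank_kernel_eq_0_iff[OF assms(1) A.exponents])
  also have "\<dots> \<longleftrightarrow> (AE (t, s) in M \<Otimes>\<^sub>M M.
       ((t, s) \<in> space M \<times> G \<longrightarrow> (h 0 - f 0) * P t s + R t s = S t s) \<and>
       ((t, s) \<in> space M \<times> (G\<^sub>A - G) \<longrightarrow> S t s = 0) \<and>
       ((t, s) \<in> space M \<times> (G\<^sub>B - G) \<longrightarrow> (f 0 - h 0) * P t s = R t s))"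
  proof (intro AE_cong, clarify)
    fix t s assume "(t, s) \<in> space (M \<Otimes>\<^sub>M M)"
    then have "t \<in> space M" by (simp add: space_pair_measure)
    then show "(\<Sum>r\<in>?I. u r t * v r s) = 0 \<longleftrightarrow>
       ((t, s) \<in> space M \<times> G \<longrightarrow> (h 0 - f 0) * P t s + R t s = S t s) \<and>
       ((t, s) \<in> space M \<times> (G\<^sub>A - G) \<longrightarrow> S t s = 0) \<and>
       ((t, s) \<in> space M \<times> (G\<^sub>B - G) \<longrightarrow> (f 0 - h 0) * P t s = R t s)"
      unfolding kernel assms(21) by (auto simp: indicator_def algebra_simps)
  qed
  finally show ?thesis
    by (simp add: P_def R_def S_def case_prod_unfold AE_conj_iff mult_ac)
qed

end
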